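(* (The Inverse Function Theorem) Let $I$ be an open interval in $\mathbb{R}$, let $f:m_{\approx}(I)\to\widehat{\mathbb{R}}$ be an injective indiscernible extension of a continuous function $\phi:I\to\mathbb{R}$ (continuous for the usual topology of $\mathbb{R}$ and its relativization to $I$), and let $\xi_0\in I$. If $m_{\approx}(\phi(I))\subseteq f(m_{\approx}(I))$, $f$ is differentiable at $\xi_0$, $f'(\xi_0)\neq0$, and $\lim_{\xi\to\xi_0}\frac{\phi(\xi)-\phi(\xi_0)}{\xi-\xi_0}$ exists in $\mathbb{R}$, then $f^{-1}$ (considered as a function with codomain $\widehat{\mathbb{R}}$) is differentiable at $\eta_0:=f(\xi_0)$, and for each $y\in m_{\approx}(\eta_0)$: $$(f^{-1})'(y)=\frac{1}{f'(f^{-1}(y))}.$$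
   Context: $\widehat{\mathbb{R}}$ is the set of all convergent sequences of real numbers; a real number is identified with the corresponding constant sequence, so $\mathbb{R}\subseteq\widehat{\mathbb{R}}$. $\sigma x\in\mathbb{R}$ is the limit of $x$; $x\approx y$ means $\sigma x=\sigma y$; $dx:=x-\sigma x$. For $x=(\xi_n),y=(\eta_n)$: $x+y:=(\xi_n+\eta_n)$, $xy:=(\sigma x\,\eta_n+\sigma y\,\xi_n-\sigma x\,\sigma y)$. $m_{\approx}(x):=\{y\in\widehat{\mathbb{R}}\mid y\approx x\}$ and $m_{\approx}(A):=\bigcup_{x\in A}m_{\approx}(x)$ for $A\subseteq\widehat{\mathbb{R}}$. A function $f:m_{\approx}(I)\to\widehat{\mathbb{R}}$ is an indiscernible extension of $\phi:I\to\mathbb{R}$ iff $f(\sigma x)=\phi(\sigma x)$ and $f(x)\approx\phi(\sigma x)$ for all $x\in m_{\approx}(I)$. For $I$ an open interval, such an $f$ is differentiable at $\xi_0\in I$ iff there is a real number $\alpha$ with $f(x)=\phi(\xi_0)+\alpha\,dx$ for all $x\in m_{\approx}(\xi_0)$, with the proviso that $\alpha=\lim_{\xi\to\xi_0}\frac{\phi(\xi)-\phi(\xi_0)}{\xi-\xi_0}$ whenever this (usual) limit exists in $\mathbb{R}$. This $\alpha$ is unique and, for each $x\in m_{\approx}(\xi_0)$, it is called the derivative of $f$ at $x$ and denoted $f'(x)$. The function $f^{-1}$ has domain $f(m_{\approx}(I))$, which under the hypotheses equals $m_{\approx}(\phi(I))$ with $\phi(I)$ an open interval; its differentiability is understood as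 that of an indiscernible extension of $\phi^{-1}:\phi(I)\to\mathbb{R}$. *)

theory Defs
  imports "HOL-Analysis.Analysis"
begin

typedef rhat = "{X :: nat \<Rightarrow> real. convergent X}"
  by (auto intro: convergent_const)

setup_lifting type_definition_rhat

lift_definition rhat_of_real :: "real \<Rightarrow> rhat" is "\<lambda>r _. r"
  by (rule convergent_const)

lift_definition std_part :: "rhat \<Rightarrow> real" ("\<sigma>") is lim .

text \<open>
  Addition is componentwise. Multiplication is not: it drops the infinitesimal part of second
  order, so that products of infinitesimals vanish.
\<close>

instantiation rhat :: comm_ring_1
begin

lift_definition zero_rhat :: rhat is "\<lambda>_. 0" by (rule convergent_const)

lift_definition one_rhat :: rhat is "\<lambda>_. 1" by (rule convergent_const)

lift_definition plus_rhat :: "rhat \<Rightarrow> rhat \<Rightarrow> rhat" is "\<lambda>X Y n. X n + Y n"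
  by (rule convergent_add)

lift_definition uminus_rhat :: "rhat \<Rightarrow> rhat" is "\<lambda>X n. - X n"
  by (simp add: convergent_minus_iff [symmetric])

lift_definition minus_rhat :: "rhat \<Rightarrow> rhat \<Rightarrow> rhat" is "\<lambda>X Y n. X n - Y n"
  by (rule convergent_diff)

lift_definition times_rhat :: "rhat \<Rightarrow> rhat \<Rightarrow> rhat"
  is "\<lambda>X Y n. lim X * Y n + lim Y * X n - lim X * lim Y"
  by (intro convergent_add convergent_diff convergent_mult convergent_const)

instance
proof
  have lim_times: "lim (\<lambda>n. lim X * Y n + lim Y * X n - lim X * lim Y) = lim X * lim Y"
    if "convergent X" "convergent Y" for X Y :: "nat \<Rightarrow> real"
  proof -
    have "X \<longlonglongrightarrow> lim X" "Y \<longlonglongrightarrow> lim Y"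
      using that by (simp_all add: convergent_LIMSEQ_iff)
    then have "(\<lambda>n. lim X * Y n + lim Y * X n - lim X * lim Y)
        \<longlonglongrightarrow> lim X * lim Y + lim Y * lim X - lim X * lim Y"
      by (intro tendsto_intros)
    then show ?thesis by (simp add: limI)
  qed
  have lim_plus: "lim (\<lambda>n. X n + Y n) = lim X + lim Y"
    if "convergent X" "convergent Y" for X Y :: "nat \<Rightarrow> real"
    using that by (intro limI tendsto_add) (simp_all add: convergent_LIMSEQ_iff)
  fix a b c :: rhat
  show "a + b + c = a + (b + c)" by transfer (simp add: add.assoc)
  show "a + b = b + a" by transfer (simp add: add.commute)
  show "0 + a = a" by transfer simp
  show "- a + a = 0" by transfer simp
  show "a - b = a + - b" by transfer simp
  show "a * b * c = a * (b * c)"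
    by transfer (simp add: lim_times, simp add: algebra_simps)
  show "a * b = b * a" by transfer (simp add: algebra_simps)
  show "1 * a = a" by transfer simp
  show "(a + b) * c = a * c + b * c"
    by transfer (simp add: lim_plus, simp add: algebra_simps)
  show "(0::rhat) \<noteq> 1" by transfer (simp add: fun_eq_iff)
qed

end

definition indisc :: "rhat \<Rightarrow> rhat \<Rightarrow> bool"
  where "indisc x y \<longleftrightarrow> \<sigma> x = \<sigma> y"

definition dpart :: "rhat \<Rightarrow> rhat"
  where "dpart x = x - rhat_of_real (\<sigma> x)"

definition monad :: "rhat \<Rightarrow> rhat set"
  where "monad x = {y. indisc y x}"

definition monads :: "rhat set \<Rightarrow> rhat set"
  where "monads A = (\<Union>x\<in>A. monad x)"

abbreviation rmonads :: "real set \<Rightarrow> rhat set"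
  where "rmonads I \<equiv> monads (rhat_of_real ` I)"

text \<open>Possibly unbounded, nonempty open intervals.\<close>

definition open_interval :: "real set \<Rightarrow> bool"
  where "open_interval I \<longleftrightarrow> open I \<and> is_interval I \<and> I \<noteq> {}"

text \<open>
  Functions with domain \<open>rmonads I\<close> or \<open>I\<close> are represented by total functions
  whose values outside the domain are irrelevant.
\<close>

definition indisc_extension :: "real set \<Rightarrow> (real \<Rightarrow> real) \<Rightarrow> (rhat \<Rightarrow> rhat) \<Rightarrow> bool"
  where "indisc_extension I \<phi> f \<longleftrightarrow>
    (\<forall>x\<in>rmonads I. f (rhat_of_real (\<sigma> x)) = rhat_of_real (\<phi> (\<sigma> x))
      \<and> indisc (f x) (rhat_of_real (\<phi> (\<sigma> x))))"

definition has_indisc_deriv ::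
  "real set \<Rightarrow> (real \<Rightarrow> real) \<Rightarrow> (rhat \<Rightarrow> rhat) \<Rightarrow> real \<Rightarrow> real \<Rightarrow> bool"
  where "has_indisc_deriv I \<phi> f \<xi>\<^sub>0 \<alpha> \<longleftrightarrow>
    open_interval I \<and> indisc_extension I \<phi> f \<and> \<xi>\<^sub>0 \<in> I
    \<and> (\<forall>x\<in>monad (rhat_of_real \<xi>\<^sub>0). f x = rhat_of_real (\<phi> \<xi>\<^sub>0) + rhat_of_real \<alpha> * dpart x)
    \<and> (\<forall>L. ((\<lambda>\<xi>. (\<phi> \<xi> - \<phi> \<xi>\<^sub>0) / (\<xi> - \<xi>\<^sub>0)) \<longlongrightarrow> L) (at \<xi>\<^sub>0 within I) \<longrightarrow> \<alpha> = L)"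

definition indisc_differentiable ::
  "real set \<Rightarrow> (real \<Rightarrow> real) \<Rightarrow> (rhat \<Rightarrow> rhat) \<Rightarrow> real \<Rightarrow> bool"
  where "indisc_differentiable I \<phi> f \<xi>\<^sub>0 \<longleftrightarrow> (\<exists>\<alpha>. has_indisc_deriv I \<phi> f \<xi>\<^sub>0 \<alpha>)"

text \<open>The derivative at \<open>x\<close> is the one at \<open>\<sigma> x\<close>.\<close>

definition indisc_deriv ::
  "real set \<Rightarrow> (real \<Rightarrow> real) \<Rightarrow> (rhat \<Rightarrow> rhat) \<Rightarrow> rhat \<Rightarrow> real"
  where "indisc_deriv I \<phi> f x = (THE \<alpha>. has_indisc_deriv I \<phi> f (\<sigma> x) \<alpha>)"

lemma has_indisc_deriv_unique:
  assumes "has_indisc_deriv I \<phi> f \<xi>\<^sub>0 \<alpha>" and "has_indisc_deriv I \<phi> f \<xi>\<^sub>0 \<beta>"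
  shows "\<alpha> = \<beta>"
proof -
  define X where "X = (\<lambda>n. \<xi>\<^sub>0 + inverse (real (Suc n)))"
  have "X \<longlonglongrightarrow> \<xi>\<^sub>0 + 0"
    unfolding X_def by (intro tendsto_add tendsto_const LIMSEQ_inverse_real_of_nat)
  then have X: "X \<longlonglongrightarrow> \<xi>\<^sub>0" by simp
  then have conv: "convergent X" and lim: "lim X = \<xi>\<^sub>0"
    by (auto simp: convergent_def limI)
  define x where "x = Abs_rhat X"
  have rep: "Rep_rhat x = X" using conv by (simp add: x_def Abs_rhat_inverse)
  have st: "\<sigma> x = \<xi>\<^sub>0" by (simp add: std_part.rep_eq rep lim)
  have "x \<in> monad (rhat_of_real \<xi>\<^sub>0)"
    by (simp add: monad_def indisc_def st) (transfer, simp)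
  then have "rhat_of_real (\<phi> \<xi>\<^sub>0) + rhat_of_real \<alpha> * dpart x
      = rhat_of_real (\<phi> \<xi>\<^sub>0) + rhat_of_real \<beta> * dpart x"
    using assms by (metis has_indisc_deriv_def)
  then have eq: "rhat_of_real \<alpha> * dpart x = rhat_of_real \<beta> * dpart x" by simp
  have d: "Rep_rhat (dpart x) = (\<lambda>n. X n - \<xi>\<^sub>0)"
    by (simp add: dpart_def minus_rhat.rep_eq rhat_of_real.rep_eq rep st)
  have "(\<lambda>n. X n - \<xi>\<^sub>0) \<longlonglongrightarrow> \<xi>\<^sub>0 - \<xi>\<^sub>0" using X by (intro tendsto_intros)
  then have "lim (\<lambda>n. X n - \<xi>\<^sub>0) = 0" by (simp add: limI)
  then have "Rep_rhat (rhat_of_real c * dpart x) 0 = c * (X 0 - \<xi>\<^sub>0)" for c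
    by (simp add: times_rhat.rep_eq rhat_of_real.rep_eq d)
  with eq have "\<alpha> * (X 0 - \<xi>\<^sub>0) = \<beta> * (X 0 - \<xi>\<^sub>0)" by metis
  then show ?thesis by (simp add: X_def)
qed

end

theory Submission
  imports Defs
begin

text \<open>
  Injectivity of \<open>f\<close> on the standard points makes \<open>\<phi>\<close> injective, so \<open>\<phi>(I)\<close> is an open interval and
  the standard part of \<open>f\<^sup>-\<^sup>1\<close> is \<open>\<phi>\<^sup>-\<^sup>1\<close>. On the monad of \<open>\<xi>\<^sub>0\<close> the map \<open>f\<close> is affine in \<open>dx\<close> with
  slope \<open>\<alpha> \<noteq> 0\<close>, and solving for \<open>dx\<close> shows that \<open>f\<^sup>-\<^sup>1\<close> is affine with slope \<open>1 / \<alpha>\<close>. Since the limit of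
  difference quotients exists, it equals \<open>\<alpha>\<close>, and the classical inverse function theorem
  yields the proviso for \<open>\<phi>\<^sup>-\<^sup>1\<close>.
\<close>

lemma std_part_rhat_of_real [simp]: "\<sigma> (rhat_of_real r) = r"
  by transfer simp

lemma rhat_of_real_mult: "rhat_of_real (a * b) = rhat_of_real a * rhat_of_real b"
  by transfer simp

lemma rhat_of_real_1: "rhat_of_real 1 = 1"
  by transfer simp

lemma rhat_of_real_eq_iff [simp]: "rhat_of_real a = rhat_of_real b \<longleftrightarrow> a = b"
  by (metis std_part_rhat_of_real)

lemma rhat_eq_std_part_plus_dpart: "x = rhat_of_real (\<sigma> x) + dpart x"
  by (simp add: dpart_def)

lemma mem_monad_rhat_of_real [simp]: "x \<in> monad (rhat_of_real r) \<longleftrightarrow> \<sigma> x = r"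
  by (simp add: monad_def indisc_def)

lemma mem_rmonads [simp]: "x \<in> rmonads I \<longleftrightarrow> \<sigma> x \<in> I"
  by (auto simp: monads_def)

lemma indisc_derivI: "has_indisc_deriv I \<phi> f (\<sigma> x) \<alpha> \<Longrightarrow> indisc_deriv I \<phi> f x = \<alpha>"
  unfolding indisc_deriv_def by (rule the_equality) (auto intro: has_indisc_deriv_unique)

lemma indisc_extension_rhat_of_real:
  "indisc_extension I \<phi> f \<Longrightarrow> \<xi> \<in> I \<Longrightarrow> f (rhat_of_real \<xi>) = rhat_of_real (\<phi> \<xi>)"
  by (metis indisc_extension_def mem_rmonads std_part_rhat_of_real)

lemma indisc_extension_std_part:
  "indisc_extension I \<phi> f \<Longrightarrow> \<sigma> x \<in> I \<Longrightarrow> \<sigma> (f x) = \<phi> (\<sigma> x)"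
  by (simp add: indisc_extension_def indisc_def)

lemma indisc_extension_inj_on:
  assumes "indisc_extension I \<phi> f" "inj_on f (rmonads I)"
  shows "inj_on \<phi> I"
proof (rule inj_onI)
  fix a b assume "a \<in> I" "b \<in> I" "\<phi> a = \<phi> b"
  then have "rhat_of_real a = rhat_of_real b"
    using indisc_extension_rhat_of_real[OF assms(1)] by (rule_tac inj_onD[OF assms(2)]) simp_all
  then show "a = b" by simp
qed

text \<open>Only one inclusion needs the surjectivity hypothesis: since \<open>f x\<close> lies in
  the monad of \<open>\<phi> (\<sigma> x)\<close>, the other is automatic.\<close>

lemma indisc_extension_image_eq:
  assumes "indisc_extension I \<phi> f" "rmonads (\<phi> ` I) \<subseteq> f ` rmonads I"
  shows "f ` rmonads I = rmonads (\<phi> ` I)"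
  using assms(2) by (auto simp: indisc_extension_std_part[OF assms(1)])

text \<open>Continuity preserves connectedness, and openness is invariance of domain in dimension
  one.\<close>

lemma open_interval_image:
  assumes "open_interval I" "continuous_on I \<phi>" "inj_on \<phi> I"
  shows "open_interval (\<phi> ` I)"
  using assms connected_continuous_image[of I \<phi>] invariance_of_domain[of I \<phi>]
  by (auto simp: open_interval_def is_interval_connected_1)

text \<open>Taking standard parts in \<open>f x = y\<close> gives
  \<open>\<phi> (\<sigma> x) = \<sigma> y\<close>, which injectivity of \<open>\<phi>\<close> solves
  for \<open>\<sigma> x\<close>.\<close>

lemma std_part_inv_into:
  assumes "indisc_extension I \<phi> f" "inj_on f (rmonads I)"
    and "rmonads (\<phi> ` I) \<subseteq> f ` rmonads I" "\<sigma> y \<in> \<phi> ` I"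
  shows "\<sigma> (inv_into (rmonads I) f y) = inv_into I \<phi> (\<sigma> y)"
proof -
  have y: "y \<in> f ` rmonads I" using assms(3,4) by (auto simp: subset_iff)
  then have "\<sigma> (inv_into (rmonads I) f y) \<in> I"
    using inv_into_into[OF y] by simp
  moreover have "f (inv_into (rmonads I) f y) = y" using y by (rule f_inv_into_f)
  ultimately show ?thesis
    using indisc_extension_std_part[OF assms(1)] indisc_extension_inj_on[OF assms(1,2)]
    by (metis inv_into_f_f)
qed

lemma indisc_extension_inv_into:
  assumes "indisc_extension I \<phi> f" "inj_on f (rmonads I)"
    and "rmonads (\<phi> ` I) \<subseteq> f ` rmonads I"
  shows "indisc_extension (\<phi> ` I) (inv_into I \<phi>) (inv_into (rmonads I) f)"
proof -
  \<comment> \<open>The standard-part lemma gives this only up to indiscernibility; exact equality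
    holds because \<open>f\<close> sends the constant on the right to \<open>\<eta>\<close> and is
    injective.\<close>
  have "inv_into (rmonads I) f (rhat_of_real \<eta>) = rhat_of_real (inv_into I \<phi> \<eta>)"
    if \<eta>: "\<eta> \<in> \<phi> ` I" for \<eta>
  proof -
    have "inv_into I \<phi> \<eta> \<in> I" "\<phi> (inv_into I \<phi> \<eta>) = \<eta>"
      using \<eta> by (auto intro: inv_into_into f_inv_into_f)
    then show ?thesis
      using indisc_extension_rhat_of_real[OF assms(1)]
      by (intro inv_into_f_eq[OF assms(2)]) simp_all
  qed
  then show ?thesis
    using std_part_inv_into[OF assms] by (simp add: indisc_extension_def indisc_def)
qed

lemma has_indisc_deriv_inv_into:
  assumes "continuous_on I \<phi>" "inj_on f (rmonads I)"
    and sub: "rmonads (\<phi> ` I) \<subseteq> f ` rmonads I"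
    and deriv: "has_indisc_deriv I \<phi> f \<xi>\<^sub>0 \<alpha>" and "\<alpha> \<noteq> 0"
    and L: "((\<lambda>\<xi>. (\<phi> \<xi> - \<phi> \<xi>\<^sub>0) / (\<xi> - \<xi>\<^sub>0)) \<longlongrightarrow> L) (at \<xi>\<^sub>0 within I)"
  shows "has_indisc_deriv (\<phi> ` I) (inv_into I \<phi>) (inv_into (rmonads I) f) (\<phi> \<xi>\<^sub>0) (1 / \<alpha>)"
proof -
  let ?g = "inv_into (rmonads I) f" and ?\<psi> = "inv_into I \<phi>"
  have I: "open_interval I" and ext: "indisc_extension I \<phi> f" and \<xi>\<^sub>0: "\<xi>\<^sub>0 \<in> I"
    and aff: "\<And>x. \<sigma> x = \<xi>\<^sub>0 \<Longrightarrow> f x = rhat_of_real (\<phi> \<xi>\<^sub>0) + rhat_of_real \<alpha> * dpart x"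
    and "L = \<alpha>"
    using deriv L by (auto simp: has_indisc_deriv_def)
  have inj: "inj_on \<phi> I" using ext assms(2) by (rule indisc_extension_inj_on)
  have J: "open_interval (\<phi> ` I)" using I assms(1) inj by (rule open_interval_image)
  have \<psi>: "?\<psi> (\<phi> \<xi>\<^sub>0) = \<xi>\<^sub>0" using inj \<xi>\<^sub>0 by simp
  have g: "?g y = rhat_of_real \<xi>\<^sub>0 + rhat_of_real (1 / \<alpha>) * dpart y" if y: "\<sigma> y = \<phi> \<xi>\<^sub>0" for y
  proof -
    have \<sigma>g: "\<sigma> (?g y) = \<xi>\<^sub>0"
      using std_part_inv_into[OF ext assms(2) sub] y \<xi>\<^sub>0 \<psi> by simp
    have "f (?g y) = y"
      using sub y \<xi>\<^sub>0 by (intro f_inv_into_f) (auto simp: subset_iff)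
    \<comment> \<open>Expand \<open>f (?g y)\<close> by the affine formula and cancel the common
      standard part \<open>\<phi> \<xi>\<^sub>0\<close>.\<close>
    then have "dpart y = rhat_of_real \<alpha> * dpart (?g y)"
      using aff[OF \<sigma>g] y by (simp add: dpart_def algebra_simps)
    \<comment> \<open>The ring is not a field, but a nonzero constant is a unit because the
      embedding of the reals is multiplicative.\<close>
    then have "rhat_of_real (1 / \<alpha>) * dpart y = dpart (?g y)"
      using \<open>\<alpha> \<noteq> 0\<close>
      by (metis mult.assoc mult_1 nonzero_eq_divide_eq rhat_of_real_1 rhat_of_real_mult)
    then show ?thesis
      using rhat_eq_std_part_plus_dpart[of "?g y"] \<sigma>g by simp
  qed
  \<comment> \<open>The proviso: a limit \<open>M\<close> of the difference quotients of
    \<open>?\<psi>\<close> is compared with its classical derivative.\<close>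
  have lim: "1 / \<alpha> = M"
    if M: "((\<lambda>\<eta>. (?\<psi> \<eta> - ?\<psi> (\<phi> \<xi>\<^sub>0)) / (\<eta> - \<phi> \<xi>\<^sub>0)) \<longlongrightarrow> M) (at (\<phi> \<xi>\<^sub>0) within \<phi> ` I)" for M
  proof -
    have "(\<phi> has_field_derivative \<alpha>) (at \<xi>\<^sub>0)"
      using L \<open>L = \<alpha>\<close> I \<xi>\<^sub>0 by (simp add: has_field_derivative_iff open_interval_def at_within_open[of _ I])
    \<comment> \<open>Continuity of \<open>\<phi>\<close> on the open set \<open>I\<close> and the
      left inverse \<open>?\<psi>\<close> suffice here; no derivative away from
      \<open>\<xi>\<^sub>0\<close> is required.\<close>
    then have "(?\<psi> has_field_derivative inverse \<alpha>) (at (\<phi> \<xi>\<^sub>0))"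
      unfolding has_field_derivative_def
      by (rule has_derivative_inverse_strong[where S = I and f' = "(*) \<alpha>", rotated -2])
        (use \<open>\<alpha> \<noteq> 0\<close> I \<xi>\<^sub>0 assms(1) inj in \<open>auto simp: open_interval_def fun_eq_iff\<close>)
    moreover have "(?\<psi> has_field_derivative M) (at (\<phi> \<xi>\<^sub>0))"
      using M J \<xi>\<^sub>0 by (simp add: has_field_derivative_iff open_interval_def at_within_open[of _ "\<phi> ` I"])
    ultimately show ?thesis
      using DERIV_unique by (fastforce simp: inverse_eq_divide)
  qed
  show ?thesis
    unfolding has_indisc_deriv_def
    using J indisc_extension_inv_into[OF ext assms(2) sub] \<xi>\<^sub>0 g lim \<psi> by simp
qed

theorem theorem5p24:
  fixes I :: "real set" and \<phi> :: "real \<Rightarrow> real" and f :: "rhat \<Rightarrow> rhat" and \<xi>\<^sub>0 :: real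
  assumes "open_interval I"
    and "continuous_on I \<phi>"
    and "indisc_extension I \<phi> f"
    and "inj_on f (rmonads I)"
    and "\<xi>\<^sub>0 \<in> I"
    and "rmonads (\<phi> ` I) \<subseteq> f ` rmonads I"
    and "indisc_differentiable I \<phi> f \<xi>\<^sub>0"
    and "indisc_deriv I \<phi> f (rhat_of_real \<xi>\<^sub>0) \<noteq> 0"
    and "\<exists>L. ((\<lambda>\<xi>. (\<phi> \<xi> - \<phi> \<xi>\<^sub>0) / (\<xi> - \<xi>\<^sub>0)) \<longlongrightarrow> L) (at \<xi>\<^sub>0 within I)"
  shows "f ` rmonads I = rmonads (\<phi> ` I) \<and>
    (\<exists>\<eta>\<^sub>0. rhat_of_real \<eta>\<^sub>0 = f (rhat_of_real \<xi>\<^sub>0) \<and>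
      indisc_differentiable (\<phi> ` I) (inv_into I \<phi>) (inv_into (rmonads I) f) \<eta>\<^sub>0 \<and>
      (\<forall>y\<in>monad (rhat_of_real \<eta>\<^sub>0).
        indisc_deriv (\<phi> ` I) (inv_into I \<phi>) (inv_into (rmonads I) f) y
          = 1 / indisc_deriv I \<phi> f (inv_into (rmonads I) f y)))"
proof -
  let ?g = "inv_into (rmonads I) f" and ?\<psi> = "inv_into I \<phi>"
  note ext = assms(3) and inj = assms(4) and \<xi>\<^sub>0 = assms(5) and sub = assms(6)
  obtain \<alpha> where \<alpha>: "has_indisc_deriv I \<phi> f \<xi>\<^sub>0 \<alpha>"
    using assms(7) by (auto simp: indisc_differentiable_def)
  then have "\<alpha> \<noteq> 0"
    using assms(8) indisc_derivI[of I \<phi> f "rhat_of_real \<xi>\<^sub>0" \<alpha>] by simp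
  then have inv: "has_indisc_deriv (\<phi> ` I) ?\<psi> ?g (\<phi> \<xi>\<^sub>0) (1 / \<alpha>)"
    using has_indisc_deriv_inv_into[OF assms(2) inj sub \<alpha>] assms(9) by blast
  have "indisc_deriv (\<phi> ` I) ?\<psi> ?g y = 1 / indisc_deriv I \<phi> f (?g y)"
    if y: "\<sigma> y = \<phi> \<xi>\<^sub>0" for y
  proof -
    \<comment> \<open>So \<open>?g y\<close> stays in the monad of \<open>\<xi>\<^sub>0\<close>,
      where the derivative of \<open>f\<close> is constantly \<open>\<alpha>\<close>.\<close>
    have "\<sigma> (?g y) = \<xi>\<^sub>0"
      using std_part_inv_into[OF ext inj sub] y \<xi>\<^sub>0 indisc_extension_inj_on[OF ext inj] by simp
    then have "indisc_deriv I \<phi> f (?g y) = \<alpha>"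
      using \<alpha> by (intro indisc_derivI) simp
    moreover have "indisc_deriv (\<phi> ` I) ?\<psi> ?g y = 1 / \<alpha>"
      using inv y by (intro indisc_derivI) simp
    ultimately show ?thesis by simp
  qed
  \<comment> \<open>The witness for \<open>\<eta>\<^sub>0\<close> is
    \<open>\<phi> \<xi>\<^sub>0\<close>.\<close>
  then show ?thesis
    using inv indisc_extension_image_eq[OF ext sub] indisc_extension_rhat_of_real[OF ext \<xi>\<^sub>0]
    unfolding indisc_differentiable_def by (metis mem_monad_rhat_of_real)
qed

end
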